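(* Let $f=[F_0,F_2]\in\mathrm{Hol}_3(S^2,\mathbb{C}P^1)$ with $F_0(z)=\sum_{i=0}^3a_iz^i$ and $F_2(z)=\sum_{i=0}^3c_iz^i$, and put $h_{ij}=a_ic_j-a_jc_i$. Then $f$ is a collapse point if and only if $3h_{03}-h_{12}=0$, i.e. if and only if $$3a_0c_3-a_1c_2+a_2c_1-3a_3c_0=0.$$
   Context: $S^2$ is identified with $\mathbb{C}\cup\{\infty\}$. $\mathrm{Hol}_d(S^2,\mathbb{C}P^1)$ is the space of holomorphic maps of degree $d$; any such $f$ is written $f=[F_0,F_2]$ with $F_0,F_2$ coprime polynomials of maximum degree exactly $d$, and is identified with the map $[F_0,0,F_2,0]:S^2\to\mathbb{C}P^3$. A holomorphic map $f=[F_0,F_1,F_2,F_3]:S^2\to\mathbb{C}P^3$ ($F_i$ polynomials) is horizontal (for the twistor fibration $\mathbb{C}P^3\to\mathbb HP^1= S^4$) if $F_1F_0'-F_0F_1'+F_3F_2'-F_2F_3'=0$. It is full if its image lies in no projective subspace $\mathbb{C}P^2$. A map $f=[F_0,F_2]\in\mathrm{Hol}_d(S^2,\mathbb{C}P^1)$ is a collapse point if $[F_0,0,F_2,0]$ lies in the closure, in the space of horizontal holomorphic maps $S^2\to\mathbb{C}P^3$ of degree $d$ (compact-open topology), of the subspace of full ones. *)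

theory Defs
  imports "HOL-Analysis.Analysis" "HOL-Computational_Algebra.Polynomial"
begin

(* The Riemann sphere: None is the point at infinity. *)
definition S2 :: "complex option topology" where
  "S2 = Alexandroff_compactification euclidean"

lemma topspace_S2 [simp]: "topspace S2 = UNIV"
  unfolding S2_def by (auto simp: notin_range_Some)

(* Points of complex projective space are the one-dimensional complex subspaces of
   complex ^ 'n (so the dimension is CARD('n) - 1); "vec" is the interpretation of
   vector spaces over the complex scalar multiplication. *)
definition proj_point :: "complex ^ 'n \<Rightarrow> (complex ^ 'n) set" where
  "proj_point v = vec.span {v}"

definition proj_points :: "(complex ^ 'n) set set" where
  "proj_points = {L. vec.subspace L \<and> vec.dim L = 1}"

(* Quotient topology with respect to v \<mapsto> proj_point v on the non-zero vectors. *)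
definition CP :: "(complex ^ 'n) set topology" where
  "CP = topology (\<lambda>U. U \<subseteq> proj_points \<and> open {v. v \<noteq> 0 \<and> proj_point v \<in> U})"

lemma openin_CP:
  fixes U :: "(complex ^ 'n) set set"
  shows "openin CP U \<longleftrightarrow> U \<subseteq> proj_points \<and> open {v. v \<noteq> 0 \<and> proj_point v \<in> U}"
proof -
  let ?P = "\<lambda>U :: (complex ^ 'n) set set. U \<subseteq> proj_points \<and> open {v. v \<noteq> 0 \<and> proj_point v \<in> U}"
  have "istopology ?P"
    unfolding istopology_def
  proof (intro conjI allI impI)
    fix S T :: "(complex ^ 'n) set set" assume S: "?P S" and T: "?P T"
    have "{v. v \<noteq> 0 \<and> proj_point v \<in> S \<inter> T} =
        {v. v \<noteq> 0 \<and> proj_point v \<in> S} \<inter> {v. v \<noteq> 0 \<and> proj_point v \<in> T}" by auto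
    then show "open {v. v \<noteq> 0 \<and> proj_point v \<in> S \<inter> T}" using S T by (auto intro: open_Int)
    show "S \<inter> T \<subseteq> proj_points" using S by auto
  next
    fix K :: "(complex ^ 'n) set set set" assume K: "\<forall>S\<in>K. ?P S"
    have "{v. v \<noteq> 0 \<and> proj_point v \<in> \<Union>K} = (\<Union>S\<in>K. {v. v \<noteq> 0 \<and> proj_point v \<in> S})" by auto
    then show "open {v. v \<noteq> 0 \<and> proj_point v \<in> \<Union>K}" using K by (auto intro: open_UN)
    show "\<Union>K \<subseteq> proj_points" using K by auto
  qed
  then show ?thesis unfolding CP_def by simp
qed

lemma proj_point_in_proj_points:
  assumes "v \<noteq> 0"
  shows "proj_point v \<in> proj_points"
proof -
  have "vec.independent {v}"
    using assms by (simp only: vec.dependent_single) simp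
  then have "vec.dim (vec.span {v}) = card {v}"
    by (rule vec.dim_span_eq_card_independent)
  then show ?thesis
    unfolding proj_points_def proj_point_def using vec.subspace_span by simp
qed

lemma topspace_CP [simp]: "topspace CP = (proj_points :: (complex ^ 'n) set set)"
proof
  have "{v :: complex ^ 'n. v \<noteq> 0 \<and> proj_point v \<in> proj_points} = - {0}"
    using proj_point_in_proj_points by blast
  moreover have "open (- {0 :: complex ^ 'n})"
    by (rule open_Compl) (rule closed_singleton)
  ultimately have "openin CP (proj_points :: (complex ^ 'n) set set)"
    unfolding openin_CP by simp
  then show "proj_points \<subseteq> topspace (CP :: (complex ^ 'n) set topology)"
    by (rule openin_subset)
  show "topspace CP \<subseteq> (proj_points :: (complex ^ 'n) set set)"
    using openin_topspace[of "CP :: (complex ^ 'n) set topology"] unfolding openin_CP by blast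
qed

(* Meant for topspace X = UNIV, where total functions need no extensionality condition. *)
definition compact_open :: "'a topology \<Rightarrow> 'b topology \<Rightarrow> ('a \<Rightarrow> 'b) topology" where
  "compact_open X Y = topology_generated_by
     {{f. continuous_map X Y f \<and> f ` K \<subseteq> U} | K U. compactin X K \<and> openin Y U}"

definition max_degree :: "complex poly ^ 'n \<Rightarrow> nat" where
  "max_degree F = Max (range (\<lambda>i. degree (F $ i)))"

definition coprime_tuple :: "complex poly ^ 'n \<Rightarrow> bool" where
  "coprime_tuple F \<longleftrightarrow> (\<forall>q. (\<forall>i. q dvd F $ i) \<longrightarrow> is_unit q)"

(* The map [F_1, ..., F_n] from S2 to CP.  At infinity it takes the limit value, i.e. the
   coefficients in degree max_degree F are the homogeneous coordinates. *)
definition rat_map :: "complex poly ^ 'n \<Rightarrow> complex option \<Rightarrow> (complex ^ 'n) set" where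
  "rat_map F p = (case p of
      Some z \<Rightarrow> proj_point (\<chi> i. poly (F $ i) z)
    | None \<Rightarrow> proj_point (\<chi> i. coeff (F $ i) (max_degree F)))"

definition Hol :: "nat \<Rightarrow> (complex option \<Rightarrow> (complex ^ 'n) set) set" where
  "Hol d = {rat_map F | F. coprime_tuple F \<and> max_degree F = d}"

(* Library vectors are indexed from 1: the homogeneous coordinates F_0, F_1, F_2, F_3
   are F $ 1, F $ 2, F $ 3, F $ 4. *)
lemma vector_4 [simp]:
  "(vector [w, x, y, z] :: 'a::zero ^ 4) $ 1 = w"
  "(vector [w, x, y, z] :: 'a::zero ^ 4) $ 2 = x"
  "(vector [w, x, y, z] :: 'a::zero ^ 4) $ 3 = y"
  "(vector [w, x, y, z] :: 'a::zero ^ 4) $ 4 = z"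
  unfolding vector_def by simp_all

definition horizontal_tuple :: "complex poly ^ 4 \<Rightarrow> bool" where
  "horizontal_tuple F \<longleftrightarrow>
     F $ 2 * pderiv (F $ 1) - F $ 1 * pderiv (F $ 2)
     + F $ 4 * pderiv (F $ 3) - F $ 3 * pderiv (F $ 4) = 0"

definition horizontal_Hol :: "nat \<Rightarrow> (complex option \<Rightarrow> (complex ^ 4) set) set" where
  "horizontal_Hol d =
     {rat_map F | F. coprime_tuple F \<and> max_degree F = d \<and> horizontal_tuple F}"

(* A projective plane in CP^3 is the set of lines contained in a subspace W of dimension 3. *)
definition full :: "(complex option \<Rightarrow> (complex ^ 4) set) \<Rightarrow> bool" where
  "full f \<longleftrightarrow>
     \<not> (\<exists>W. vec.subspace W \<and> vec.dim W = 3 \<and> range f \<subseteq> {L \<in> proj_points. L \<subseteq> W})"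

definition horizontal_space :: "nat \<Rightarrow> (complex option \<Rightarrow> (complex ^ 4) set) topology" where
  "horizontal_space d = subtopology (compact_open S2 CP) (horizontal_Hol d)"

(* The inclusion of CP^1 in CP^3 given by [x, y] \<mapsto> [x, 0, y, 0]. *)
definition incl :: "complex ^ 2 \<Rightarrow> complex ^ 4" where
  "incl v = vector [v $ 1, 0, v $ 2, 0]"

definition CP1_in_CP3 ::
    "(complex option \<Rightarrow> (complex ^ 2) set) \<Rightarrow> complex option \<Rightarrow> (complex ^ 4) set" where
  "CP1_in_CP3 f p = incl ` f p"

lemma incl_proj_point: "incl ` proj_point v = proj_point (incl v)"
proof -
  have "incl (k *s v) = k *s incl v" for k
    by (simp add: incl_def vec_eq_iff forall_4)
  then show ?thesis
    by (auto simp: proj_point_def vec.span_singleton image_iff)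
qed

lemma CP1_in_CP3_rat_map:
  "CP1_in_CP3 (rat_map (vector [F0, F2])) = rat_map (vector [F0, 0, F2, 0])"
proof -
  have "range (\<lambda>i. degree ((vector [F0, 0, F2, 0] :: complex poly ^ 4) $ i)) =
      {degree F0, 0, degree F2}"
    by (auto simp: UNIV_4)
  moreover have "range (\<lambda>i. degree ((vector [F0, F2] :: complex poly ^ 2) $ i)) =
      {degree F0, degree F2}"
    by (auto simp: UNIV_2)
  ultimately have deg: "max_degree (vector [F0, 0, F2, 0] :: complex poly ^ 4) =
      max_degree (vector [F0, F2] :: complex poly ^ 2)"
    by (simp add: max_degree_def)
  have "incl (\<chi> i. g ((vector [F0, F2] :: complex poly ^ 2) $ i)) =
      (\<chi> i. g ((vector [F0, 0, F2, 0] :: complex poly ^ 4) $ i))"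
    if "g 0 = 0" for g :: "complex poly \<Rightarrow> complex"
    by (simp add: incl_def vec_eq_iff forall_4 that)
  from this[of "\<lambda>q. poly q _"] this[of "\<lambda>q. coeff q _"] show ?thesis
    by (intro ext) (simp add: CP1_in_CP3_def rat_map_def incl_proj_point deg split: option.split)
qed

definition collapse_point :: "nat \<Rightarrow> (complex option \<Rightarrow> (complex ^ 2) set) \<Rightarrow> bool" where
  "collapse_point d f \<longleftrightarrow> f \<in> Hol d \<and>
     CP1_in_CP3 f \<in> horizontal_space d closure_of {g \<in> horizontal_Hol d. full g}"

end

theory Submission
  imports Defs
    "HOL-Computational_Algebra.Field_as_Ring"
    "HOL-Computational_Algebra.Polynomial_Factorial"
begin

text \<open>
  The expression \<open>3 h\<^sub>0\<^sub>3 - h\<^sub>1\<^sub>2\<close> is, up to scale, the \<open>SL\<^sub>2\<close>-invariant symplectic form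
  \<open>\<omega>\<close> on binary cubics, evaluated at \<open>(F\<^sub>0, F\<^sub>2)\<close>. Horizontality of \<open>[F\<^sub>0, F\<^sub>1, F\<^sub>2, F\<^sub>3]\<close> says that
  the bivector \<open>F\<^sub>0 \<and> F\<^sub>1 + F\<^sub>2 \<and> F\<^sub>3\<close> is a multiple of the bivector dual to \<open>\<omega>\<close>. Contracting
  it with \<open>\<omega>(-, F\<^sub>2)\<close> gives a linear relation between \<open>F\<^sub>0, F\<^sub>1, F\<^sub>2\<close> in which \<open>F\<^sub>1\<close> has
  coefficient \<open>\<omega>(F\<^sub>0, F\<^sub>2)\<close>, so \<open>\<omega>(F\<^sub>0, F\<^sub>2) = 0\<close> for full maps. This equation is closed: a
  map of degree 3 is determined by its values at 7 points, and coefficient vectors can be normalised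
  to a compact sphere.

  Conversely, if \<open>\<omega>(F\<^sub>0, F\<^sub>2) = 0\<close>, complete \<open>F\<^sub>0, F\<^sub>2\<close> to a symplectic basis
  \<open>F\<^sub>0, F\<^sub>1, F\<^sub>2, F\<^sub>3\<close>. Since horizontality is linear in \<open>(F\<^sub>1, F\<^sub>3)\<close>, the maps
  \<open>[F\<^sub>0, t F\<^sub>1, F\<^sub>2, t F\<^sub>3]\<close> are horizontal, and they are full for \<open>t \<noteq> 0\<close>.
\<close>

section \<open>Polynomials of degree at most 3 as coefficient vectors\<close>

definition cubic :: "complex ^ 4 \<Rightarrow> complex poly" where
  "cubic v = [:v $ 1, v $ 2, v $ 3, v $ 4:]"

definition cubics :: "complex ^ 4 ^ 'n \<Rightarrow> complex poly ^ 'n" where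
  "cubics C = (\<chi> i. cubic (C $ i))"

definition omega :: "complex ^ 4 \<Rightarrow> complex ^ 4 \<Rightarrow> complex" where
  "omega x y = 3 * (x $ 1 * y $ 4 - x $ 4 * y $ 1) - (x $ 2 * y $ 3 - x $ 3 * y $ 2)"

lemma cubics_nth [simp]: "cubics C $ i = cubic (C $ i)"
  by (simp add: cubics_def)

lemma coeff_cubic:
  "coeff (cubic v) 0 = v $ 1" "coeff (cubic v) (Suc 0) = v $ 2"
  "coeff (cubic v) 2 = v $ 3" "coeff (cubic v) 3 = v $ 4"
  by (simp_all add: cubic_def numeral_2_eq_2 numeral_3_eq_3)

lemma poly_cubic: "poly (cubic v) z = v $ 1 + z * (v $ 2 + z * (v $ 3 + z * v $ 4))"
  by (simp add: cubic_def)

lemma degree_cubic_le: "degree (cubic v) \<le> 3"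
  by (simp add: cubic_def)

lemma cubic_inject: "cubic v = cubic w \<longleftrightarrow> v = w"
  by (auto simp: cubic_def vec_eq_iff forall_4)

lemma cubic_0 [simp]: "cubic 0 = 0"
  by (simp add: cubic_def)

lemma cubic_eq_0_iff: "cubic v = 0 \<longleftrightarrow> v = 0"
  using cubic_inject[of v 0] by simp

lemma degree_le_3_imp_cubic:
  assumes "degree p \<le> 3"
  shows "p = cubic (vector [coeff p 0, coeff p 1, coeff p 2, coeff p 3])"
proof (rule poly_eqI)
  fix n
  show "coeff p n = coeff (cubic (vector [coeff p 0, coeff p 1, coeff p 2, coeff p 3])) n"
  proof (cases "n \<le> 3")
    case True
    then have "n = 0 \<or> n = 1 \<or> n = 2 \<or> n = 3" by auto
    then show ?thesis by (auto simp: coeff_cubic)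
  next
    case False
    then show ?thesis
      using assms degree_cubic_le[of "vector [coeff p 0, coeff p 1, coeff p 2, coeff p 3]"]
      by (simp add: coeff_eq_0)
  qed
qed

lemma degree_le_max_degree: "degree (F $ i) \<le> max_degree F"
  by (simp add: max_degree_def)

lemma max_degree_attained: "\<exists>i. degree (F $ i) = max_degree F"
proof -
  have "max_degree F \<in> range (\<lambda>i. degree (F $ i))"
    unfolding max_degree_def by (rule Max_in) auto
  then show ?thesis by auto
qed

lemma max_degree_le_3_imp_cubics:
  assumes "max_degree F \<le> 3"
  obtains C where "F = cubics C"
proof
  show "F = cubics (\<chi> i. vector [coeff (F $ i) 0, coeff (F $ i) 1, coeff (F $ i) 2, coeff (F $ i) 3])"
    using assms degree_le_3_imp_cubic[OF order_trans[OF degree_le_max_degree[of F]]]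
    by (simp add: vec_eq_iff)
qed

section \<open>Horizontality as a condition on a bivector\<close>

lemma horizontal_cubics_iff:
  "horizontal_tuple (cubics C) \<longleftrightarrow>
    (let A = (\<lambda>i j. C $ 1 $ i * C $ 2 $ j - C $ 1 $ j * C $ 2 $ i
                  + C $ 3 $ i * C $ 4 $ j - C $ 3 $ j * C $ 4 $ i)
     in A 1 2 = 0 \<and> A 1 3 = 0 \<and> 3 * A 1 4 + A 2 3 = 0 \<and> A 2 4 = 0 \<and> A 3 4 = 0)"
proof -
  let ?A = "\<lambda>i j. C $ 1 $ i * C $ 2 $ j - C $ 1 $ j * C $ 2 $ i
                  + C $ 3 $ i * C $ 4 $ j - C $ 3 $ j * C $ 4 $ i"
  \<comment> \<open>The Wronskian of \<open>z^p\<close> and \<open>z^q\<close> is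
    \<open>(q - p) * z^(p + q - 1)\<close>. Only the index pairs 1, 4 and 2, 3 meet in the same
    power, with weights 3 and 1; every other bivector entry must vanish on its own.\<close>
  have "cubics C $ 2 * pderiv (cubics C $ 1) - cubics C $ 1 * pderiv (cubics C $ 2)
      + cubics C $ 4 * pderiv (cubics C $ 3) - cubics C $ 3 * pderiv (cubics C $ 4)
    = [: - ?A 1 2, - 2 * ?A 1 3, - (3 * ?A 1 4 + ?A 2 3), - 2 * ?A 2 4, - ?A 3 4:]"
    by (simp add: cubic_def pderiv_pCons algebra_simps)
  then show ?thesis
    unfolding horizontal_tuple_def Let_def
    by (simp only: pCons_eq_0_iff mult_eq_0_iff neg_equal_0_iff_equal) simp
qed

lemma horizontal_imp_omega_relation:
  assumes "horizontal_tuple (cubics C)"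
  obtains \<alpha> \<beta> where "omega (C $ 1) (C $ 3) *s C $ 2 = \<alpha> *s C $ 1 + \<beta> *s C $ 3"
proof
  \<comment> \<open>\<open>?l\<close> is the bivector entry \<open>A 1 4\<close>; horizontality
    makes \<open>A 2 3\<close> equal to \<open>- 3 * ?l\<close> and the remaining entries zero.
    Contracting such a bivector with \<open>omega _ y\<close> gives \<open>3 * ?l\<close> times
    \<open>y\<close>, hence the extra summand at \<open>C $ 3\<close>.\<close>
  let ?l = "C $ 1 $ 1 * C $ 2 $ 4 - C $ 1 $ 4 * C $ 2 $ 1 + C $ 3 $ 1 * C $ 4 $ 4 - C $ 3 $ 4 * C $ 4 $ 1"
  show "omega (C $ 1) (C $ 3) *s C $ 2
      = omega (C $ 2) (C $ 3) *s C $ 1 + (omega (C $ 4) (C $ 3) + 3 * ?l) *s C $ 3"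
    using assms unfolding horizontal_cubics_iff Let_def omega_def vec_eq_iff forall_4
    by (intro conjI; simp; algebra)
qed

section \<open>Values of the map, planes and fullness\<close>

definition evaluation :: "complex ^ 4 ^ 'n \<Rightarrow> complex \<Rightarrow> complex ^ 'n" where
  "evaluation C z = (\<chi> i. poly (cubic (C $ i)) z)"

lemma rat_map_cubics_Some: "rat_map (cubics C) (Some z) = proj_point (evaluation C z)"
  by (simp add: rat_map_def evaluation_def)

lemma rat_map_cubics_None:
  assumes "max_degree (cubics C) = 3"
  shows "rat_map (cubics C) None = proj_point (\<chi> i. C $ i $ 4)"
  using assms by (simp add: rat_map_def coeff_cubic)

lemma evaluation_nonzero:
  assumes "coprime_tuple (cubics C)"
  shows "evaluation C z \<noteq> 0"
proof
  assume "evaluation C z = 0"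
  then have "[:-z, 1:] dvd cubics C $ i" for i
    by (simp add: evaluation_def vec_eq_iff poly_eq_0_iff_dvd)
  then have "is_unit [:-z, 1:]"
    using assms unfolding coprime_tuple_def by blast
  then show False
    by (simp add: is_unit_iff_degree)
qed

lemma leading_coeffs_nonzero:
  fixes C :: "complex ^ 4 ^ 'n"
  assumes "max_degree (cubics C) = 3"
  shows "(\<chi> i. C $ i $ 4) \<noteq> 0"
proof
  assume *: "(\<chi> i. C $ i $ 4) = 0"
  obtain i where i: "degree (cubic (C $ i)) = 3"
    using max_degree_attained[of "cubics C"] assms by auto
  then have "C $ i $ 4 \<noteq> 0"
    by (metis coeff_cubic(4) degree_0 leading_coeff_0_iff zero_neq_numeral)
  then show False
    using * by (simp add: vec_eq_iff)
qed

lemma rat_map_in_proj_points: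
  assumes "coprime_tuple (cubics C)" "max_degree (cubics C) = 3"
  shows "rat_map (cubics C) p \<in> proj_points"
  using assms
  by (cases p) (simp_all add: rat_map_cubics_None rat_map_cubics_Some proj_point_in_proj_points
      evaluation_nonzero leading_coeffs_nonzero)

lemma dim_hyperplane_solved_for_2:
  fixes d \<alpha> \<beta> :: complex
  assumes "d \<noteq> 0"
  defines "W \<equiv> {v :: complex ^ 4. d * v $ 2 = \<alpha> * v $ 1 + \<beta> * v $ 3}"
  shows "vec.subspace W" "vec.dim W = 3"
proof -
  show "vec.subspace W"
    by (rule vec.subspaceI) (simp_all add: W_def algebra_simps)
  let ?u = "vector [1, \<alpha> / d, 0, 0] :: complex ^ 4" and ?v = "vector [0, \<beta> / d, 1, 0] :: complex ^ 4"
    and ?w = "vector [0, 0, 0, 1] :: complex ^ 4"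
  have "vec.independent {?u, ?v, ?w}"
    by (simp add: vec.independent_insert vec.span_singleton vec.span_breakdown_eq vec_eq_iff
        forall_4 image_iff)
  moreover have "card {?u, ?v, ?w} = 3"
    by (simp add: card_insert_if vec_eq_iff forall_4)
  moreover have "{?u, ?v, ?w} \<subseteq> W"
    using assms by (simp add: W_def)
  moreover have "W \<subseteq> vec.span {?u, ?v, ?w}"
  proof
    fix x assume "x \<in> W"
    then have "x $ 2 = x $ 1 * (\<alpha> / d) + x $ 3 * (\<beta> / d)"
      using assms(1) by (simp add: W_def field_simps)
    then have "x = x $ 1 *s ?u + x $ 3 *s ?v + x $ 4 *s ?w"
      by (simp add: vec_eq_iff forall_4)
    also have "\<dots> \<in> vec.span {?u, ?v, ?w}"
      by (intro vec.span_add vec.span_scale vec.span_base) auto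
    finally show "x \<in> vec.span {?u, ?v, ?w}" .
  qed
  ultimately show "vec.dim W = 3"
    by (intro vec.dim_unique)
qed

text \<open>A basis of \<open>W\<close> fills some rows of a square matrix and the other rows are
  zero. The rows span too little, so the matrix is singular, and a nonzero kernel vector annihilates
  the basis.\<close>

lemma proper_subspace_annihilator:
  fixes W :: "(complex ^ 'n) set"
  assumes "vec.dim W < CARD('n)"
  obtains x where "x \<noteq> 0" "\<And>v. v \<in> W \<Longrightarrow> (\<Sum>i\<in>UNIV. v $ i * x $ i) = 0"
proof -
  obtain B where B: "B \<subseteq> W" "vec.independent B" "W \<subseteq> vec.span B" "card B = vec.dim W"
    using vec.basis_exists by blast
  have "finite B"
    using B(2) by (rule vec.finiteI_independent)
  then obtain h :: "complex ^ 'n \<Rightarrow> 'n" where h: "inj_on h B"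
    using assms B(4) by (metis card_le_inj finite_class.finite_UNIV less_imp_le)
  define A :: "complex ^ 'n ^ 'n" where
    "A = (\<chi> i. if i \<in> h ` B then inv_into B h i else 0)"
  have rows: "rows A \<subseteq> vec.span B"
    by (auto simp: rows_def row_def A_def inv_into_into vec_lambda_eta vec.span_zero
        intro: vec.span_base)
  have "vec.dim (rows A) \<le> vec.dim (vec.span B)"
    using rows by (rule vec.dim_subset)
  also have "\<dots> < CARD('n)"
    using assms B by (simp add: vec.dim_eq_card_independent)
  finally have "vec.span (rows A) \<noteq> UNIV"
    by (metis order_less_irrefl vec.dim_UNIV vec.dim_span card_cart_basis vec.dimension_def)
  then obtain x where x: "A *v x = 0" "x \<noteq> 0"
    using matrix_left_invertible_span_rows_gen[of A] matrix_left_invertible_ker[of A] by blast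
  let ?N = "{v. (\<Sum>i\<in>UNIV. v $ i * x $ i) = 0}"
  have "B \<subseteq> ?N"
  proof
    fix b assume b: "b \<in> B"
    then have "A $ (h b) = b"
      using h by (simp add: A_def)
    moreover have "(A *v x) $ (h b) = 0"
      using x by simp
    ultimately show "b \<in> ?N"
      by (simp add: matrix_vector_mult_def)
  qed
  moreover have "vec.subspace ?N"
    by (rule vec.subspaceI)
      (simp_all add: distrib_right sum.distrib mult.assoc flip: sum_distrib_left)
  ultimately have "vec.span B \<subseteq> ?N"
    by (rule vec.span_minimal)
  then show thesis
    using that x(2) B(3) by blast
qed

text \<open>A linear relation between coefficient vectors passes to the values at all finite points
  and to the leading coefficients, which give the value at infinity. If \<open>omega\<close> were
  nonzero, the relation would confine the image to the plane \<open>W\<close>.\<close>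

lemma full_horizontal_imp_omega_0:
  assumes "coprime_tuple (cubics C)" "max_degree (cubics C) = 3" "horizontal_tuple (cubics C)"
    and "full (rat_map (cubics C))"
  shows "omega (C $ 1) (C $ 3) = 0"
proof (rule ccontr)
  assume nz: "omega (C $ 1) (C $ 3) \<noteq> 0"
  obtain \<alpha> \<beta> where *: "omega (C $ 1) (C $ 3) *s C $ 2 = \<alpha> *s C $ 1 + \<beta> *s C $ 3"
    using horizontal_imp_omega_relation[OF assms(3)] .
  then have j: "omega (C $ 1) (C $ 3) * C $ 2 $ j = \<alpha> * C $ 1 $ j + \<beta> * C $ 3 $ j" for j
    by (simp add: vec_eq_iff)
  define W where "W = {v :: complex ^ 4. omega (C $ 1) (C $ 3) * v $ 2 = \<alpha> * v $ 1 + \<beta> * v $ 3}"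
  note W = dim_hyperplane_solved_for_2[OF nz, of \<alpha> \<beta>, folded W_def]
  have "evaluation C z \<in> W" for z
    using j[of 1] j[of 2] j[of 3] j[of 4] unfolding W_def mem_Collect_eq evaluation_def
    by (simp add: poly_cubic) algebra
  moreover have "(\<chi> i. C $ i $ 4) \<in> W"
    using j[of 4] by (simp add: W_def)
  ultimately have "rat_map (cubics C) p \<subseteq> W" for p
    using W(1) assms(2)
    by (cases p) (simp_all add: rat_map_cubics_None rat_map_cubics_Some proj_point_def
        vec.span_minimal)
  then have "range (rat_map (cubics C)) \<subseteq> {L \<in> proj_points. L \<subseteq> W}"
    using rat_map_in_proj_points[OF assms(1,2)] by auto
  then show False
    using assms(4) W unfolding full_def by blast
qed

text \<open>A plane containing the image would supply one fixed combination of the four cubics that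
  vanishes at every finite point, hence identically.\<close>

lemma independent_imp_full:
  assumes "\<And>x. (\<Sum>i\<in>UNIV. x $ i *s C $ i) = 0 \<Longrightarrow> x = 0"
  shows "full (rat_map (cubics C))"
proof -
  have False if W: "vec.dim W = 3" and sub: "range (rat_map (cubics C)) \<subseteq> {L \<in> proj_points. L \<subseteq> W}" for W
  proof -
    obtain x where x: "x \<noteq> 0" "\<And>v. v \<in> W \<Longrightarrow> (\<Sum>i\<in>UNIV. v $ i * x $ i) = 0"
      using proper_subspace_annihilator[of W] W by auto
    have "evaluation C z \<in> W" for z
    proof -
      have "proj_point (evaluation C z) \<subseteq> W"
        using sub rat_map_cubics_Some[of C z] by (metis (mono_tags, lifting) image_subset_iff mem_Collect_eq UNIV_I)
      then show ?thesis
        by (auto simp: proj_point_def intro: vec.span_base)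
    qed
    then have "poly (cubic (\<Sum>i\<in>UNIV. x $ i *s C $ i)) z = 0" for z
      using x(2)[of "evaluation C z"]
      by (simp add: evaluation_def poly_cubic sum_4 algebra_simps)
    then have "(\<Sum>i\<in>UNIV. x $ i *s C $ i) = 0"
      using poly_all_0_iff_0 cubic_eq_0_iff by blast
    then show False
      using assms x(1) by blast
  qed
  then show ?thesis
    unfolding full_def by blast
qed

section \<open>Symplectic linear algebra on cubics\<close>

lemma omega_solve_pair:
  assumes "a $ i * c $ j \<noteq> a $ j * c $ i"
  obtains b where "omega a b = r" "omega c b = s"
proof -
  define u where "u = (\<lambda>x :: complex ^ 4. vector [- 3 * x $ 4, x $ 3, - x $ 2, 3 * x $ 1] :: complex ^ 4)"
  have omega: "omega x b = (\<Sum>k\<in>UNIV. u x $ k * b $ k)" for x b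
    by (simp add: u_def omega_def sum_4 algebra_simps)
  \<comment> \<open>Nondegeneracy of \<open>omega\<close>: up to signs and factors 3,
    \<open>u\<close> permutes coordinates, so the 2x2 minors of \<open>u a\<close>,
    \<open>u c\<close> are nonzero multiples of those of \<open>a\<close>, \<open>c\<close>.\<close>
  have "\<exists>k l. u a $ k * u c $ l \<noteq> u a $ l * u c $ k"
  proof (rule ccontr)
    assume "\<not> ?thesis"
    then have "u a $ k * u c $ l = u a $ l * u c $ k" for k l
      by blast
    from this[of 1 2] this[of 1 3] this[of 1 4] this[of 2 3] this[of 2 4] this[of 3 4]
    have "\<forall>k l. a $ k * c $ l = a $ l * c $ k"
      unfolding forall_4 by (simp add: u_def)
    then show False using assms by blast
  qed
  then obtain k l where kl: "u a $ k * u c $ l - u a $ l * u c $ k \<noteq> 0" (is "?d \<noteq> 0")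
    by auto
  \<comment> \<open>Cramer's rule in the coordinates \<open>k\<close> and \<open>l\<close>, all
    others being set to zero.\<close>
  define b where "b = axis k ((r * u c $ l - s * u a $ l) / ?d) + axis l ((s * u a $ k - r * u c $ k) / ?d)"
  have axis: "(\<Sum>m\<in>UNIV. w m * axis n y $ m) = w n * y" for w and y :: complex and n :: 4
    by (simp add: axis_def if_distrib cong: if_cong)
  have sum: "(\<Sum>m\<in>UNIV. w m * b $ m) =
      w k * ((r * u c $ l - s * u a $ l) / ?d) + w l * ((s * u a $ k - r * u c $ k) / ?d)" for w
    by (simp add: b_def distrib_left sum.distrib axis)
  show thesis
  proof
    show "omega a b = r" "omega c b = s"
      unfolding omega sum using kl by (simp_all add: divide_simps) (simp_all add: algebra_simps)
  qed
qed

lemma symplectic_basis: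
  fixes C :: "complex ^ 4 ^ 4"
  assumes "omega (C $ 1) (C $ 2) = 1" "omega (C $ 3) (C $ 4) = 1"
    and "omega (C $ 1) (C $ 3) = 0" "omega (C $ 1) (C $ 4) = 0"
    and "omega (C $ 3) (C $ 2) = 0" "omega (C $ 2) (C $ 4) = 0"
  shows "horizontal_tuple (cubics C)"
    and "(\<Sum>i\<in>UNIV. x $ i *s C $ i) = 0 \<Longrightarrow> x = 0"
proof -
  \<comment> \<open>Here \<open>u y\<close> represents \<open>omega _ y\<close>, with the varying
    vector in the first argument, so the signs are opposite to those in
    \<open>omega_solve_pair\<close>.\<close>
  define u where "u = (\<lambda>x :: complex ^ 4. vector [3 * x $ 4, - x $ 3, x $ 2, - 3 * x $ 1] :: complex ^ 4)"
  have omega: "(\<Sum>k\<in>UNIV. u y $ k * x $ k) = omega x y" for x y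
    by (simp add: u_def omega_def sum_4 algebra_simps)
  have skew: "omega x y = - omega y x" for x y
    by (simp add: omega_def algebra_simps)
  have self: "omega x x = 0" for x
    by (simp add: omega_def algebra_simps)
  \<comment> \<open>The rows of \<open>N\<close> are the coordinate functionals of the symplectic basis. Reading
    \<open>N C\<^sup>T = 1\<close> as \<open>C\<^sup>T N = 1\<close> turns the symplectic relations into horizontality.\<close>
  define N :: "complex ^ 4 ^ 4" where
    "N = vector [u (C $ 2), - u (C $ 1), u (C $ 4), - u (C $ 3)]"
  have NC: "(N ** transpose C) $ i $ j = (\<Sum>k\<in>UNIV. N $ i $ k * C $ j $ k)" for i j
    by (simp add: matrix_matrix_mult_def transpose_def)
  have NM: "N ** transpose C = mat 1"
    unfolding vec_eq_iff[of "N ** transpose C"] vec_eq_iff[of "(N ** transpose C) $ _"] NC forall_4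
    using assms skew[of "C $ 2" "C $ 1"] skew[of "C $ 4" "C $ 3"] skew[of "C $ 3" "C $ 1"]
      skew[of "C $ 4" "C $ 1"] skew[of "C $ 2" "C $ 3"] skew[of "C $ 4" "C $ 2"]
    by (simp add: N_def sum_negf omega self mat_def)
  then have "transpose C ** N = mat 1"
    by (rule matrix_left_right_inverse1)
  then have E: "(\<Sum>k\<in>UNIV. C $ k $ i * N $ k $ j) = (if i = j then 1 else 0)" for i j
    by (simp add: vec_eq_iff matrix_matrix_mult_def transpose_def mat_def)
  \<comment> \<open>Entry j of \<open>u x\<close> is a signed multiple of coordinate 5 - j of
    \<open>x\<close>, so entry (i, j) of \<open>E\<close> is a multiple of the bivector entry (i, 5
    - j). The off-diagonal entries used give the four vanishing conditions; the diagonal ones give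
    \<open>3 * A 1 4 = 1\<close> and \<open>A 2 3 = - 1\<close>.\<close>
  show "horizontal_tuple (cubics C)"
    unfolding horizontal_cubics_iff Let_def
    using E[of 1 3] E[of 1 2] E[of 1 1] E[of 2 2] E[of 4 3] E[of 4 2]
    by (intro conjI; simp add: sum_4 N_def u_def; algebra)
  show "x = 0" if "(\<Sum>i\<in>UNIV. x $ i *s C $ i) = 0"
  proof -
    have "transpose C *v x = 0"
      using that by (simp add: vec_eq_iff matrix_vector_mult_def transpose_def mult.commute)
    then have "(N ** transpose C) *v x = 0"
      by (simp flip: matrix_vector_mul_assoc)
    then show ?thesis
      by (simp add: NM)
  qed
qed

text \<open>With \<open>b\<close> and \<open>e\<close> found separately, only
  \<open>omega b e = 0\<close> can fail. Subtracting a multiple of \<open>c\<close> from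
  \<open>b\<close> repairs this because \<open>omega c e = 1\<close>; the values against
  \<open>a\<close> and \<open>c\<close> survive because \<open>omega a c = 0\<close> and
  \<open>omega c c = 0\<close>.\<close>

lemma extend_to_symplectic_basis:
  assumes "a $ i * c $ j \<noteq> a $ j * c $ i" "omega a c = 0"
  obtains b e where "omega a b = 1" "omega c e = 1" "omega a e = 0" "omega c b = 0" "omega b e = 0"
proof -
  obtain b where b: "omega a b = 1" "omega c b = 0"
    using omega_solve_pair[OF assms(1)] .
  obtain e where e: "omega a e = 0" "omega c e = 1"
    using omega_solve_pair[OF assms(1)] .
  let ?b = "b - omega b e *s c"
  have lin: "omega x ?b = omega x b - omega b e * omega x c"
    "omega ?b x = omega b x - omega b e * omega c x" for x
    by (simp_all add: omega_def right_diff_distrib left_diff_distrib)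
  have "omega c c = 0"
    by (simp add: omega_def)
  show thesis
  proof (rule that)
    show "omega a ?b = 1" "omega c ?b = 0" "omega ?b e = 0"
      unfolding lin using b e assms(2) \<open>omega c c = 0\<close> by simp_all
  qed (fact e)+
qed

text \<open>If all minors vanished, one cubic would be a multiple of the other, possibly zero, and
  the divisor would have degree 3, against coprimality.\<close>

lemma coprime_cubics_independent:
  assumes "coprime (cubic a) (cubic c)" "max (degree (cubic a)) (degree (cubic c)) = 3"
  obtains i j where "a $ i * c $ j \<noteq> a $ j * c $ i"
proof -
  have False if "\<And>i j. a $ i * c $ j = a $ j * c $ i"
  proof -
    have *: "smult (c $ 4) (cubic a) = smult (a $ 4) (cubic c)"
      using that[of 1 4] that[of 2 4] that[of 3 4] by (simp add: cubic_def mult.commute)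
    have "c $ 4 \<noteq> 0 \<or> a $ 4 \<noteq> 0"
      using assms(2) by (auto simp: cubic_def split: if_splits)
    then have "cubic a dvd cubic c \<and> degree (cubic a) = 3 \<or> cubic c dvd cubic a \<and> degree (cubic c) = 3"
    proof (cases "c $ 4 = 0")
      case True
      then have "a $ 4 \<noteq> 0" "cubic c = 0"
        using * \<open>c $ 4 \<noteq> 0 \<or> a $ 4 \<noteq> 0\<close> by auto
      then show ?thesis
        by (simp add: cubic_def)
    next
      case False
      then have "cubic a = smult (a $ 4 / c $ 4) (cubic c)"
        using arg_cong[OF *, of "smult (inverse (c $ 4))"] by (simp add: field_simps)
      then show ?thesis
        using False by (metis coeff_cubic(4) degree_cubic_le dvd_refl dvd_smult le_antisym le_degree)
    qed
    then show False
      using assms(1) is_unit_iff_degree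
      by (metis coprime_absorb_left coprime_absorb_right degree_0 zero_neq_numeral)
  qed
  then show thesis
    using that by blast
qed

section \<open>Continuity into projective space and the compact-open topology\<close>

lemma proj_point_scale: "k \<noteq> 0 \<Longrightarrow> proj_point (k *s v) = proj_point v"
  unfolding proj_point_def
proof (intro equalityI vec.span_minimal)
  assume "k \<noteq> 0"
  then have "v = inverse k *s (k *s v)"
    by (simp add: vec_eq_iff)
  also have "\<dots> \<in> vec.span {k *s v}"
    by (intro vec.span_scale vec.span_base) simp
  finally show "{v} \<subseteq> vec.span {k *s v}"
    by simp
qed (auto intro: vec.span_scale vec.span_base)

lemma proj_point_eqD:
  assumes "proj_point v = proj_point w" "w \<noteq> 0"
  obtains k where "k \<noteq> 0" "w = k *s v"
proof -
  have "w \<in> range (\<lambda>k. k *s v)"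
    using assms(1) vec.span_base[of w "{w}"] by (simp add: proj_point_def vec.span_singleton)
  then show thesis
    using assms(2) that by auto
qed

text \<open>Source of the test neighbourhoods used later: invariance under scaling makes the set of
  vectors saturated for the quotient map to \<open>CP\<close>.\<close>

lemma openin_CP_homogeneous:
  fixes P :: "complex ^ 'n \<Rightarrow> bool"
  assumes "open {v. P v}" and "\<And>k v. k \<noteq> 0 \<Longrightarrow> P (k *s v) \<longleftrightarrow> P v"
  shows "openin CP (proj_point ` {v. v \<noteq> 0 \<and> P v})"
    and "v \<noteq> 0 \<Longrightarrow> proj_point v \<in> proj_point ` {v. v \<noteq> 0 \<and> P v} \<longleftrightarrow> P v"
proof -
  show *: "proj_point v \<in> proj_point ` {v. v \<noteq> 0 \<and> P v} \<longleftrightarrow> P v" if "v \<noteq> 0" for v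
    using that assms(2) by (auto elim!: proj_point_eqD)
  then have "{v. v \<noteq> 0 \<and> proj_point v \<in> proj_point ` {v. v \<noteq> 0 \<and> P v}} = {v. P v} - {0}"
    by blast
  then show "openin CP (proj_point ` {v. v \<noteq> 0 \<and> P v})"
    unfolding openin_CP using assms(1) proj_point_in_proj_points
    by (auto intro: open_delete)
qed

text \<open>Homogeneous coordinates in the chart \<open>w = 1 / z\<close> around infinity, which
  corresponds to \<open>w = 0\<close>.\<close>

definition reversed_evaluation :: "complex ^ 4 ^ 'n \<Rightarrow> complex \<Rightarrow> complex ^ 'n" where
  "reversed_evaluation C w = (\<chi> i. C $ i $ 4 + w * (C $ i $ 3 + w * (C $ i $ 2 + w * C $ i $ 1)))"

lemma evaluation_eq_reversed:
  assumes "z \<noteq> 0"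
  shows "evaluation C z = z ^ 3 *s reversed_evaluation C (inverse z)"
  unfolding vec_eq_iff evaluation_def reversed_evaluation_def poly_cubic
    vector_smult_component vec_lambda_beta
  using right_inverse[OF assms] by algebra

lemma continuous_on_evaluation:
  assumes "continuous_on S f" "continuous_on S g"
  shows "continuous_on S (\<lambda>x. evaluation (f x) (g x))"
  unfolding evaluation_def poly_cubic by (intro continuous_intros assms)

lemma continuous_on_reversed_evaluation:
  assumes "continuous_on S f" "continuous_on S g"
  shows "continuous_on S (\<lambda>x. reversed_evaluation (f x) (g x))"
  unfolding reversed_evaluation_def by (intro continuous_intros assms)

text \<open>Joint continuity in parameter and point is what yields continuity into the compact-open
  topology. \<open>evaluation\<close> is a continuous nonzero lift over finite points;
  \<open>reversed_evaluation\<close> lifts the map near infinity and is nonzero at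
  \<open>w = 0\<close> because the maximal degree is exactly 3.\<close>

lemma continuous_map_rat_map_cubics:
  fixes C :: "'b::topological_space \<Rightarrow> complex ^ 4 ^ 'n"
  assumes cont: "continuous_on UNIV C"
    and C: "\<And>t. coprime_tuple (cubics (C t))" "\<And>t. max_degree (cubics (C t)) = 3"
  shows "continuous_map (prod_topology euclidean S2) CP (\<lambda>(t, p). rat_map (cubics (C t)) p)"
proof -
  let ?\<phi> = "\<lambda>t p. rat_map (cubics (C t)) p"
  have "openin (prod_topology euclidean S2) {(t, p). ?\<phi> t p \<in> U}" if U: "openin CP U" for U
    unfolding openin_prod_topology_alt
  proof (intro allI impI)
    let ?O = "{v. v \<noteq> 0 \<and> proj_point v \<in> U}"
    have O: "open ?O" using U by (simp add: openin_CP)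
    have cont': "continuous_on UNIV (\<lambda>x :: 'b \<times> complex. C (fst x))"
      by (rule continuous_on_compose2[OF cont]) (auto intro: continuous_intros)
    fix t p assume "(t, p) \<in> {(t, p). ?\<phi> t p \<in> U}"
    then have tp: "?\<phi> t p \<in> U" by simp
    show "\<exists>A B. openin euclidean A \<and> openin S2 B \<and> t \<in> A \<and> p \<in> B \<and> A \<times> B \<subseteq> {(t, p). ?\<phi> t p \<in> U}"
    proof (cases p)
      case (Some z)
      let ?P = "(\<lambda>x. evaluation (C (fst x)) (snd x)) -` ?O"
      have "open ?P"
        by (intro open_vimage O continuous_on_evaluation cont' continuous_intros)
      moreover have "(t, z) \<in> ?P"
        using tp Some C(1) by (simp add: rat_map_cubics_Some evaluation_nonzero)
      ultimately obtain A B where AB: "open A" "open B" "t \<in> A" "z \<in> B" "A \<times> B \<subseteq> ?P"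
        by (rule open_prod_elim) auto
      have "A \<times> Some ` B \<subseteq> {(t, p). ?\<phi> t p \<in> U}"
        using AB(5) by (auto simp: rat_map_cubics_Some)
      moreover have "openin S2 (Some ` B)"
        using AB(2) by (auto simp: S2_def openin_Alexandroff_compactification)
      ultimately show ?thesis
        using AB Some by (intro exI[of _ A] exI[of _ "Some ` B"]) auto
    next
      case None
      let ?P = "(\<lambda>x. reversed_evaluation (C (fst x)) (snd x)) -` ?O"
      have None_eq: "?\<phi> s None = proj_point (reversed_evaluation (C s) 0)" for s
        using C(2) by (simp add: rat_map_cubics_None reversed_evaluation_def)
      have "reversed_evaluation (C t) 0 \<noteq> 0"
        using leading_coeffs_nonzero[OF C(2)] by (simp add: reversed_evaluation_def)
      then have mem: "(t, 0) \<in> ?P"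
        using tp None None_eq by simp
      have "open ?P"
        by (intro open_vimage O continuous_on_reversed_evaluation cont' continuous_intros)
      then obtain A B where AB: "open A" "open B" "t \<in> A" "0 \<in> B" "A \<times> B \<subseteq> ?P"
        using mem by (rule open_prod_elim) auto
      obtain r where r: "r > 0" "ball 0 r \<subseteq> B"
        using AB by (meson open_contains_ball)
      \<comment> \<open>The image of \<open>ball 0 r\<close> under \<open>w = 1 / z\<close>, written
        as the complement of a compact disc and hence a neighbourhood of infinity.\<close>
      let ?V = "insert None (Some ` (UNIV - cball 0 (1 / r)))"
      have "openin S2 ?V"
        unfolding S2_def openin_Alexandroff_compactification
        by (intro disjI2 exI[of _ "cball 0 (1 / r)"]) simp
      moreover have "?\<phi> s q \<in> U" if s: "s \<in> A" and q: "q \<in> ?V" for s q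
      proof (cases q)
        case None
        then show ?thesis using None_eq AB s by auto
      next
        case (Some z)
        then have z: "norm z > 1 / r" using q by auto
        then have nz: "z \<noteq> 0" using r by auto
        have "inverse z \<in> B"
          using z r nz by (intro subsetD[OF r(2)]) (simp add: norm_divide divide_simps mult.commute)
        then have "proj_point (reversed_evaluation (C s) (inverse z)) \<in> U"
          using AB(5) s by auto
        then show ?thesis
          using Some nz by (simp add: rat_map_cubics_Some evaluation_eq_reversed proj_point_scale)
      qed
      ultimately show ?thesis
        using AB None by (intro exI[of _ A] exI[of _ ?V]) auto
    qed
  qed
  moreover have "?\<phi> t p \<in> proj_points" for t p
    using C by (rule rat_map_in_proj_points)
  ultimately show ?thesis
    by (auto simp: continuous_map_def case_prod_unfold)
qed

text \<open>A tube lemma argument: projection along the compact \<open>K\<close> is a closed map, so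
  the parameters whose slice leaves \<open>U\<close> somewhere on \<open>K\<close> form a closed
  set.\<close>

lemma continuous_map_into_compact_open:
  assumes "continuous_map (prod_topology X Y) Z (\<lambda>(t, p). \<phi> t p)"
  shows "continuous_map X (compact_open Y Z) \<phi>"
proof -
  have slice: "continuous_map Y Z (\<phi> t)" if "t \<in> topspace X" for t
  proof -
    have "continuous_map Y (prod_topology X Y) (\<lambda>p. (t, p))"
      using that by (simp add: continuous_map_pairedI)
    from continuous_map_compose[OF this assms] show ?thesis
      by (simp add: o_def)
  qed
  have "openin X {t \<in> topspace X. \<phi> t ` K \<subseteq> U}" if K: "compactin Y K" and U: "openin Z U" for K U
  proof -
    let ?Y = "subtopology Y K"
    have KY: "topspace ?Y = K"
      using compactin_subset_topspace[OF K] by auto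
    have "continuous_map (prod_topology X ?Y) Z (\<lambda>(t, p). \<phi> t p)"
      using continuous_map_from_subtopology[OF assms, of "topspace X \<times> K"]
      by (simp add: prod_topology_subtopology)
    then have "closedin (prod_topology X ?Y) {x \<in> topspace (prod_topology X ?Y). (\<lambda>(t, p). \<phi> t p) x \<in> topspace Z - U}"
      using U by (intro closedin_continuous_map_preimage) auto
    moreover have "closed_map (prod_topology X ?Y) X fst"
      using K by (intro closed_map_fst) (simp add: compactin_subspace)
    ultimately have "closedin X (fst ` {x \<in> topspace (prod_topology X ?Y). (\<lambda>(t, p). \<phi> t p) x \<in> topspace Z - U})"
      by (simp only: closed_map_def)
    also have "fst ` {x \<in> topspace (prod_topology X ?Y). (\<lambda>(t, p). \<phi> t p) x \<in> topspace Z - U}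
        = {t \<in> topspace X. \<exists>p\<in>K. \<phi> t p \<in> topspace Z - U}"
      using compactin_subset_topspace[OF K] by (force simp: image_iff)
    finally have "openin X (topspace X - {t \<in> topspace X. \<exists>p\<in>K. \<phi> t p \<in> topspace Z - U})"
      by (rule openin_diff[OF openin_topspace])
    moreover have "\<phi> t p \<in> topspace Z" if "t \<in> topspace X" "p \<in> K" for t p
      using slice[OF that(1)] that(2) compactin_subset_topspace[OF K] by (auto simp: continuous_map_def)
    then have "topspace X - {t \<in> topspace X. \<exists>p\<in>K. \<phi> t p \<in> topspace Z - U} = {t \<in> topspace X. \<phi> t ` K \<subseteq> U}"
      by auto
    ultimately show ?thesis by simp
  qed
  moreover have "\<phi> -` {f. continuous_map Y Z f \<and> f ` K \<subseteq> U} \<inter> topspace X = {t \<in> topspace X. \<phi> t ` K \<subseteq> U}" for K U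
    using slice by auto
  \<comment> \<open>The generated topology lives on the union of its generators;
    \<open>K = {}\<close> and \<open>U = {}\<close> give the generator of all continuous
    maps.\<close>
  moreover have "\<phi> t \<in> \<Union> {{f. continuous_map Y Z f \<and> f ` K \<subseteq> U} |K U. compactin Y K \<and> openin Z U}"
    if "t \<in> topspace X" for t
  proof -
    have "\<phi> t \<in> {f. continuous_map Y Z f \<and> f ` {} \<subseteq> {}}"
      using slice[OF that] by simp
    then show ?thesis
      using compactin_empty openin_empty by blast
  qed
  ultimately show ?thesis
    unfolding compact_open_def continuous_on_generated_topo_iff by auto
qed

section \<open>A quantitative separation by values at 7 points\<close>

lemma cubic_scale: "cubic (k *s v) = smult k (cubic v)"
  by (simp add: cubic_def)

definition l1_norm :: "complex ^ 'n \<Rightarrow> real" where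
  "l1_norm v = (\<Sum>i\<in>UNIV. cmod (v $ i))"

text \<open>For nonzero \<open>v\<close> the quotient \<open>deviation x v / l1_norm v\<close>
  depends only on the line through \<open>v\<close>, and for nonzero \<open>x\<close> it measures
  how far that line is from the one through \<open>x\<close>.\<close>

definition deviation :: "complex ^ 'n \<Rightarrow> complex ^ 'n \<Rightarrow> real" where
  "deviation x v = (\<Sum>i\<in>UNIV. \<Sum>j\<in>UNIV. cmod (v $ i * x $ j - v $ j * x $ i))"

lemma deviation_nonneg: "0 \<le> deviation x v"
  by (simp add: deviation_def sum_nonneg)

lemma deviation_self: "deviation x x = 0"
  by (simp add: deviation_def)

lemma deviation_eq_0_iff: "deviation x v = 0 \<longleftrightarrow> (\<forall>i j. v $ i * x $ j = v $ j * x $ i)"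
  by (auto simp: deviation_def sum_nonneg_eq_0_iff sum_nonneg)

lemma deviation_scale: "deviation x (k *s v) = cmod k * deviation x v"
  by (simp add: deviation_def sum_distrib_left norm_mult[symmetric] right_diff_distrib mult.assoc)

lemma l1_norm_scale: "l1_norm (k *s v) = cmod k * l1_norm v"
  by (simp add: l1_norm_def sum_distrib_left norm_mult)

lemma l1_norm_pos: "v \<noteq> 0 \<Longrightarrow> 0 < l1_norm v"
  unfolding l1_norm_def vec_eq_iff
  by (metis (no_types, lifting) finite_class.finite_UNIV UNIV_I norm_ge_zero sum_pos2 zero_index zero_less_norm_iff)

lemma poly_eq_0_if_roots_of_nat:
  fixes p :: "'a::{idom, ring_char_0} poly"
  assumes "degree p < n" "\<And>k. k < n \<Longrightarrow> poly p (of_nat k) = 0"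
  shows "p = 0"
proof (rule ccontr)
  assume p: "p \<noteq> 0"
  have "n = card (of_nat ` {..<n} :: 'a set)"
    by (simp add: card_image inj_on_def)
  also have "\<dots> \<le> card {x. poly p x = 0}"
    using assms(2) poly_roots_finite[OF p] by (intro card_mono) auto
  also have "\<dots> \<le> degree p"
    by (rule card_poly_roots_bound[OF p])
  finally show False using assms(1) by simp
qed

text \<open>Products of two cubics have degree at most 6, so minors vanishing at 7 points vanish
  identically. Coprimality then gives \<open>C $ 1\<close> and \<open>C $ 3\<close> a common
  cofactor over \<open>a\<close> and \<open>c\<close>. \<open>C\<close> may have common factors,
  even zeros at the test points, which allows arbitrary points of the unit sphere later.\<close>

lemma proportional_at_7_points:
  fixes C :: "complex ^ 4 ^ 4"
  assumes coprime: "coprime (cubic a) (cubic c)"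
    and degree: "max (degree (cubic a)) (degree (cubic c)) = 3" and "C \<noteq> 0"
    and dev: "\<And>k. k < 7 \<Longrightarrow> deviation (evaluation (vector [a, 0, c, 0]) (of_nat k)) (evaluation C (of_nat k)) = 0"
  obtains q where "q \<noteq> 0" "C = vector [q *s a, 0, q *s c, 0]"
proof -
  define B :: "complex ^ 4 ^ 4" where "B = vector [a, 0, c, 0]"
  have proportional: "cubic (C $ i) * cubic (B $ j) = cubic (C $ j) * cubic (B $ i)" for i j
  proof -
    let ?p = "cubic (C $ i) * cubic (B $ j) - cubic (C $ j) * cubic (B $ i)"
    have "degree (cubic (C $ k) * cubic (B $ l)) \<le> 6" for k l
      using degree_mult_le[of "cubic (C $ k)" "cubic (B $ l)"] degree_cubic_le[of "C $ k"]
        degree_cubic_le[of "B $ l"] by linarith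
    then have "degree ?p \<le> 6"
      by (intro degree_diff_le)
    moreover have "poly ?p (of_nat k) = 0" if "k < 7" for k
      using dev[OF that] by (simp add: deviation_eq_0_iff evaluation_def B_def)
    ultimately have "?p = 0"
      by (intro poly_eq_0_if_roots_of_nat[of _ 7]) auto
    then show ?thesis by simp
  qed
  have not_unit: "\<not> is_unit p" if "degree p = 3" for p :: "complex poly"
    using that by (metis degree_0 is_unit_iff_degree zero_neq_numeral)
  have nz: "cubic a \<noteq> 0" "cubic c \<noteq> 0"
    using coprime degree not_unit by auto
  have "C $ 2 = 0" "C $ 4 = 0"
    using proportional[of 2 1] proportional[of 4 1] nz by (simp_all add: B_def cubic_eq_0_iff)
  have 13: "cubic (C $ 1) * cubic c = cubic (C $ 3) * cubic a"
    using proportional[of 1 3] by (simp add: B_def)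
  then have "cubic a dvd cubic (C $ 1) * cubic c"
    by simp
  then have "cubic a dvd cubic (C $ 1)"
    using coprime by (simp add: coprime_dvd_mult_left_iff)
  then obtain p where p: "cubic (C $ 1) = p * cubic a"
    by (metis dvd_def mult.commute)
  with 13 nz have p': "cubic (C $ 3) = p * cubic c"
    by (simp add: mult.assoc mult.left_commute)
  have "p \<noteq> 0"
    using p p' \<open>C $ 2 = 0\<close> \<open>C $ 4 = 0\<close> \<open>C \<noteq> 0\<close> by (auto simp: vec_eq_iff[of C] forall_4 cubic_eq_0_iff)
  \<comment> \<open>One of \<open>a\<close>, \<open>c\<close> gives degree exactly 3, while its
    product with \<open>p\<close> is again a cubic, so \<open>p\<close> is constant.\<close>
  then have "degree p + 3 \<le> 3"
    using degree degree_cubic_le[of "C $ 1"] degree_cubic_le[of "C $ 3"] nz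
    by (auto simp: p p' degree_mult_eq max_def split: if_splits)
  then obtain q where q: "p = [:q:]"
    by (metis add_le_same_cancel2 degree_eq_zeroE le_zero_eq)
  show thesis
  proof
    show "q \<noteq> 0" using q \<open>p \<noteq> 0\<close> by simp
    show "C = vector [q *s a, 0, q *s c, 0]"
      using p p' q \<open>C $ 2 = 0\<close> \<open>C $ 4 = 0\<close>
      by (simp add: vec_eq_iff[of C] forall_4 flip: cubic_scale cubic_inject)
  qed
qed

text \<open>On the compact set \<open>K\<close> of normalised \<open>C\<close> with vanishing
  \<open>omega\<close>, the total deviation is at least some \<open>m > 0\<close> and the total norm
  at most some \<open>M\<close>; \<open>m / M\<close> serves as the bound. Both sides of the
  deviation inequality scale alike, so \<open>C\<close> may be normalised before the 7 inequalities
  are summed.\<close>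

lemma omega_separation:
  assumes "coprime (cubic a) (cubic c)" "max (degree (cubic a)) (degree (cubic c)) = 3"
    and "omega a c \<noteq> 0"
  defines "X \<equiv> \<lambda>k :: nat. evaluation (vector [a, 0, c, 0] :: complex ^ 4 ^ 4) (of_nat k)"
  obtains \<epsilon> where "\<epsilon> > 0" and "\<And>C :: complex ^ 4 ^ 4. C \<noteq> 0 \<Longrightarrow>
      (\<And>k. k < 7 \<Longrightarrow> deviation (X k) (evaluation C (of_nat k))
          < \<epsilon> * l1_norm (evaluation C (of_nat k))) \<Longrightarrow> omega (C $ 1) (C $ 3) \<noteq> 0"
proof -
  define \<phi> where "\<phi> = (\<lambda>C. \<Sum>k<7. deviation (X k) (evaluation C (of_nat k)))"
  define N where "N = (\<lambda>C :: complex ^ 4 ^ 4. \<Sum>k<7. l1_norm (evaluation C (of_nat k)))"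
  define K where "K = sphere (0 :: complex ^ 4 ^ 4) 1 \<inter> {C. omega (C $ 1) (C $ 3) = 0}"
  have "closed {C :: complex ^ 4 ^ 4. omega (C $ 1) (C $ 3) = 0}"
    unfolding omega_def by (intro closed_Collect_eq continuous_intros)
  then have "compact K"
    unfolding K_def by (intro compact_Int_closed compact_sphere)
  have "continuous_on K \<phi>"
    unfolding \<phi>_def deviation_def by (intro continuous_intros continuous_on_evaluation)
  have "continuous_on K N"
    unfolding N_def l1_norm_def by (intro continuous_intros continuous_on_evaluation)
  have "0 \<notin> \<phi> ` K"
  proof
    assume "0 \<in> \<phi> ` K"
    then obtain C where C: "C \<in> K" "\<phi> C = 0" by auto
    then have dev: "deviation (X k) (evaluation C (of_nat k)) = 0" if "k < 7" for k
      using that by (simp add: \<phi>_def sum_nonneg_eq_0_iff deviation_nonneg)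
    have "C \<noteq> 0"
      using C(1) by (auto simp: K_def)
    from proportional_at_7_points[OF assms(1,2) this dev[unfolded X_def]]
    obtain q where "q \<noteq> 0" "C = vector [q *s a, 0, q *s c, 0]"
      by blast
    moreover have "omega (q *s a) (q *s c) = q ^ 2 * omega a c"
      by (simp add: omega_def algebra_simps power2_eq_square)
    ultimately show False
      using C(1) assms(3) by (simp add: K_def)
  qed
  moreover have "closed (\<phi> ` K)"
    using \<open>compact K\<close> \<open>continuous_on K \<phi>\<close> by (intro compact_imp_closed compact_continuous_image)
  ultimately obtain m where m: "m > 0" "\<And>y. y \<in> \<phi> ` K \<Longrightarrow> m \<le> dist 0 y"
    using separate_point_closed by metis
  have "bounded (N ` K)"
    using \<open>compact K\<close> \<open>continuous_on K N\<close> by (intro compact_imp_bounded compact_continuous_image)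
  then obtain M where M: "M > 0" "\<And>y. y \<in> N ` K \<Longrightarrow> norm y \<le> M"
    by (meson bounded_pos)
  have "omega (C $ 1) (C $ 3) \<noteq> 0"
    if C: "C \<noteq> 0" and dev: "\<And>k. k < 7 \<Longrightarrow> deviation (X k) (evaluation C (of_nat k))
          < m / M * l1_norm (evaluation C (of_nat k))" for C
  proof
    assume 0: "omega (C $ 1) (C $ 3) = 0"
    define r where "r = complex_of_real (1 / norm C)"
    have "r \<noteq> 0" using C by (simp add: r_def)
    define D where "D = (1 / norm C) *\<^sub>R C"
    have D: "D $ i = r *s C $ i" for i
      by (simp add: D_def r_def vec_eq_iff scaleR_conv_of_real[where 'a = complex])
    have ev: "evaluation D z = r *s evaluation C z" for z
      by (simp add: evaluation_def D cubic_scale vec_eq_iff)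
    have "norm D = 1" using C by (simp add: D_def)
    moreover have "omega (D $ 1) (D $ 3) = 0"
      using 0 unfolding D omega_def by simp algebra
    ultimately have "D \<in> K" by (simp add: K_def)
    have "\<phi> D < (\<Sum>k<7. m / M * l1_norm (evaluation D (of_nat k)))"
      unfolding \<phi>_def
    proof (rule sum_strict_mono)
      fix k assume "k \<in> {..<7::nat}"
      then show "deviation (X k) (evaluation D (of_nat k)) < m / M * l1_norm (evaluation D (of_nat k))"
        using mult_strict_left_mono[OF dev[of k], of "cmod r"] \<open>r \<noteq> 0\<close>
        by (simp add: ev deviation_scale l1_norm_scale mult.left_commute)
    qed (auto simp: lessThan_empty_iff)
    also have "\<dots> = m / M * N D"
      by (simp add: N_def sum_distrib_left)
    also have "\<dots> \<le> m / M * M"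
      using M(2)[of "N D"] \<open>D \<in> K\<close> M(1) m(1) by (intro mult_left_mono) auto
    also have "\<dots> = m" using M by simp
    also have "m \<le> \<phi> D"
      using m(2)[of "\<phi> D"] \<open>D \<in> K\<close> by (simp add: \<phi>_def sum_nonneg deviation_nonneg)
    finally show False by simp
  qed
  then show thesis
    using that[of "m / M"] m(1) M(1) by simp
qed

section \<open>Closure of the full maps\<close>

lemma openin_deviation:
  fixes x :: "complex ^ 'n" and \<epsilon> :: real
  defines "U \<equiv> proj_point ` {v. v \<noteq> 0 \<and> deviation x v < \<epsilon> * l1_norm v}"
  shows "openin CP U"
    and "v \<noteq> 0 \<Longrightarrow> proj_point v \<in> U \<longleftrightarrow> deviation x v < \<epsilon> * l1_norm v"
proof -
  have open_P: "open {v. deviation x v < \<epsilon> * l1_norm v}"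
    unfolding deviation_def l1_norm_def by (intro open_Collect_less continuous_intros)
  have hom_P: "deviation x (k *s v) < \<epsilon> * l1_norm (k *s v) \<longleftrightarrow> deviation x v < \<epsilon> * l1_norm v"
    if "k \<noteq> 0" for k v
    using that by (simp add: deviation_scale l1_norm_scale mult.left_commute)
  note hom = openin_CP_homogeneous[OF open_P hom_P]
  show "openin CP U"
    unfolding U_def by (rule hom(1))
  show "proj_point v \<in> U \<longleftrightarrow> deviation x v < \<epsilon> * l1_norm v" if "v \<noteq> 0"
    unfolding U_def by (rule hom(2), assumption, fact that)
qed

text \<open>Points are compact, so 7 open conditions on values define a neighbourhood
  \<open>T\<close> of the given map. If \<open>omega a c\<close> were nonzero,
  \<open>omega_separation\<close> would make \<open>omega\<close> nonzero for all horizontal maps in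
  \<open>T\<close>, so none of them could be full.\<close>

lemma in_closure_imp_omega_0:
  assumes coprime: "coprime (cubic a) (cubic c)"
    and degree: "max (degree (cubic a)) (degree (cubic c)) = 3"
    and closure: "rat_map (cubics (vector [a, 0, c, 0])) \<in>
      horizontal_space 3 closure_of {g \<in> horizontal_Hol 3. full g}" (is "?f \<in> _")
  shows "omega a c = 0"
proof (rule ccontr)
  assume "omega a c \<noteq> 0"
  define X where "X = (\<lambda>k :: nat. evaluation (vector [a, 0, c, 0] :: complex ^ 4 ^ 4) (of_nat k))"
  obtain \<epsilon> where \<epsilon>: "\<epsilon> > 0" "\<And>C :: complex ^ 4 ^ 4. C \<noteq> 0 \<Longrightarrow>
      (\<And>k. k < 7 \<Longrightarrow> deviation (X k) (evaluation C (of_nat k))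
          < \<epsilon> * l1_norm (evaluation C (of_nat k))) \<Longrightarrow> omega (C $ 1) (C $ 3) \<noteq> 0"
    using omega_separation[OF coprime degree \<open>omega a c \<noteq> 0\<close>] unfolding X_def by blast
  define U where "U = (\<lambda>k. proj_point ` {v. v \<noteq> 0 \<and> deviation (X k) v < \<epsilon> * l1_norm v})"
  have "?f \<in> topspace (horizontal_space 3)"
    using closure by (simp only: in_closure_of)
  then have f: "continuous_map S2 CP ?f" "?f \<in> horizontal_Hol 3"
    by (auto simp: horizontal_space_def compact_open_def)
  have X: "X k \<noteq> 0" for k
  proof
    assume "X k = 0"
    then have "poly (cubic a) (of_nat k) = 0" "poly (cubic c) (of_nat k) = 0"
      by (simp_all add: X_def evaluation_def vec_eq_iff forall_4)
    then show False
      using coprime_poly_0[OF coprime] by blast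
  qed
  define T where "T = horizontal_Hol 3 \<inter>
    (\<Inter>k<7. {g. continuous_map S2 CP g \<and> g ` {Some (of_nat k)} \<subseteq> U k})"
  have "openin (compact_open S2 CP) {g. continuous_map S2 CP g \<and> g ` {Some (of_nat k)} \<subseteq> U k}" for k
    unfolding compact_open_def
    by (rule topology_generated_by_Basis, rule CollectI,
        rule exI[of _ "{Some (of_nat k)}"], rule exI[of _ "U k"])
      (simp add: U_def openin_deviation)
  then have "openin (compact_open S2 CP) (\<Inter>k<7. {g. continuous_map S2 CP g \<and> g ` {Some (of_nat k)} \<subseteq> U k})"
    by (intro openin_Inter) (auto simp: lessThan_empty_iff)
  then have "openin (horizontal_space 3) T"
    unfolding horizontal_space_def T_def openin_subtopology by blast
  moreover have "proj_point (X k) \<in> U k" for k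
    using X \<epsilon>(1) by (simp add: U_def openin_deviation l1_norm_pos deviation_self)
  then have "?f \<in> T"
    using f by (simp add: T_def rat_map_cubics_Some X_def)
  ultimately obtain g where g: "g \<in> horizontal_Hol 3" "full g" "g \<in> T"
    using closure unfolding in_closure_of by blast
  then obtain F where F: "g = rat_map F" "coprime_tuple F" "max_degree F = 3" "horizontal_tuple F"
    unfolding horizontal_Hol_def by blast
  then obtain C where "F = cubics C"
    using max_degree_le_3_imp_cubics[of F] by auto
  note C = F[unfolded this]
  have "C \<noteq> 0"
    using leading_coeffs_nonzero[OF C(3)] by (auto simp: vec_eq_iff)
  moreover have "deviation (X k) (evaluation C (of_nat k)) < \<epsilon> * l1_norm (evaluation C (of_nat k))"
    if "k < 7" for k
    using g(3) that C(1) evaluation_nonzero[OF C(2)]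
    by (auto simp: T_def rat_map_cubics_Some U_def openin_deviation)
  ultimately have "omega (C $ 1) (C $ 3) \<noteq> 0"
    using \<epsilon>(2) by blast
  then show False
    using full_horizontal_imp_omega_0 C g(2) by blast
qed

lemma omega_0_imp_in_closure:
  assumes coprime: "coprime (cubic a) (cubic c)"
    and degree: "max (degree (cubic a)) (degree (cubic c)) = 3"
    and "omega a c = 0"
  shows "rat_map (cubics (vector [a, 0, c, 0])) \<in>
    horizontal_space 3 closure_of {g \<in> horizontal_Hol 3. full g}"
proof -
  obtain i j where "a $ i * c $ j \<noteq> a $ j * c $ i"
    using coprime_cubics_independent[OF coprime degree] .
  then obtain b e where be: "omega a b = 1" "omega c e = 1" "omega a e = 0" "omega c b = 0" "omega b e = 0"
    using extend_to_symplectic_basis assms(3) by blast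
  define C :: "complex \<Rightarrow> complex ^ 4 ^ 4" where
    "C = (\<lambda>t. vector [a, t *s b, c, t *s e])"
  have C_nth: "C t $ 1 = a" "C t $ 2 = t *s b" "C t $ 3 = c" "C t $ 4 = t *s e" for t
    by (simp_all add: C_def)
  have "omega (C 1 $ 1) (C 1 $ 2) = 1" "omega (C 1 $ 3) (C 1 $ 4) = 1"
    "omega (C 1 $ 1) (C 1 $ 3) = 0" "omega (C 1 $ 1) (C 1 $ 4) = 0"
    "omega (C 1 $ 3) (C 1 $ 2) = 0" "omega (C 1 $ 2) (C 1 $ 4) = 0"
    using be assms(3) by (simp_all add: C_nth)
  note basis = symplectic_basis[OF this]
  have "continuous_on UNIV (\<lambda>t. C t $ i $ j)" for i j
    using exhaust_4[of i] by (elim disjE; simp add: C_nth; intro continuous_intros)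
  then have "continuous_on UNIV (\<lambda>t. \<chi> i j. C t $ i $ j)"
    by (intro continuous_on_vec_lambda)
  then have cont: "continuous_on UNIV C"
    by (simp add: vec_lambda_eta)
  \<comment> \<open>\<open>a\<close> and \<open>c\<close> are entries of \<open>C t\<close> for
    every \<open>t\<close>, so coprimality and degree 3 persist along the whole family.\<close>
  have cop: "coprime_tuple (cubics (C t))" for t
    using coprime unfolding coprime_tuple_def
    by (metis C_nth(1,3) coprime_common_divisor cubics_nth)
  have "\<exists>i. degree (cubics (C t) $ i) = 3" for t
    using degree C_nth(1,3) by (metis cubics_nth max_def)
  moreover have "degree (cubics (C t) $ i) \<le> 3" for t i
    by (simp add: degree_cubic_le)
  ultimately have deg: "max_degree (cubics (C t)) = 3" for t
    by (metis degree_le_max_degree max_degree_attained order_antisym)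
  \<comment> \<open>The bivector of \<open>C t\<close> is \<open>t\<close> times that of
    \<open>C 1\<close>.\<close>
  have "horizontal_tuple (cubics (C t))" for t
    using basis(1) unfolding horizontal_cubics_iff Let_def C_nth
    by (intro conjI; simp; algebra)
  then have hol: "rat_map (cubics (C t)) \<in> horizontal_Hol 3" for t
    using cop deg unfolding horizontal_Hol_def by blast
  have full: "full (rat_map (cubics (C t)))" if "t \<noteq> 0" for t
  proof (rule independent_imp_full)
    fix x assume x: "(\<Sum>i\<in>UNIV. x $ i *s C t $ i) = 0"
    \<comment> \<open>The factors \<open>t\<close> move from the vectors to the coefficients, giving
      a relation in the basis \<open>C 1\<close>; \<open>t\<close> is cancelled at the end.\<close>
    let ?y = "vector [x $ 1, x $ 2 * t, x $ 3, x $ 4 * t] :: complex ^ 4"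
    have "(\<Sum>i\<in>UNIV. ?y $ i *s C 1 $ i) = (\<Sum>i\<in>UNIV. x $ i *s C t $ i)"
      by (simp add: sum_4 C_nth)
    then have "?y = 0"
      using x by (rule basis(2)[OF trans])
    then show "x = 0"
      using that by (simp add: vec_eq_iff forall_4)
  qed
  have "continuous_map euclidean (compact_open S2 CP) (\<lambda>t. rat_map (cubics (C t)))"
    using continuous_map_rat_map_cubics[OF cont cop deg] by (rule continuous_map_into_compact_open)
  then have "continuous_map euclidean (horizontal_space 3) (\<lambda>t. rat_map (cubics (C t)))"
    unfolding horizontal_space_def using hol by (auto intro: continuous_map_into_subtopology)
  \<comment> \<open>The parameter 0 is a limit of nonzero parameters, and continuity carries this
    over to the maps.\<close>
  then have "(\<lambda>t. rat_map (cubics (C t))) ` (euclidean closure_of (- {0}))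
      \<subseteq> horizontal_space 3 closure_of ((\<lambda>t. rat_map (cubics (C t))) ` (- {0}))"
    by (rule continuous_map_image_closure_subset)
  also have "\<dots> \<subseteq> horizontal_space 3 closure_of {g \<in> horizontal_Hol 3. full g}"
    using hol full by (intro closure_of_mono) auto
  finally have "rat_map (cubics (C 0)) \<in> horizontal_space 3 closure_of {g \<in> horizontal_Hol 3. full g}"
    by (auto simp: closure_complement)
  then show ?thesis by (simp add: C_def)
qed

theorem mainTheorem7:
  fixes f :: "complex option \<Rightarrow> (complex ^ 2) set"
    and F0 F2 :: "complex poly"
    and a c :: "nat \<Rightarrow> complex"
    and h :: "nat \<Rightarrow> nat \<Rightarrow> complex"
  assumes "f \<in> Hol 3"
    and "f = rat_map (vector [F0, F2])"
    and "coprime F0 F2" and "max (degree F0) (degree F2) = 3"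
    and "F0 = (\<Sum>i\<le>3. monom (a i) i)"
    and "F2 = (\<Sum>i\<le>3. monom (c i) i)"
    and "\<And>i j. h i j = a i * c j - a j * c i"
  shows "(collapse_point 3 f \<longleftrightarrow> 3 * h 0 3 - h 1 2 = 0) \<and>
    (collapse_point 3 f \<longleftrightarrow>
      3 * a 0 * c 3 - a 1 * c 2 + a 2 * c 1 - 3 * a 3 * c 0 = 0)"
proof -
  define u where "u = (\<lambda>b :: nat \<Rightarrow> complex. vector [b 0, b 1, b 2, b 3] :: complex ^ 4)"
  have cubic: "(\<Sum>i\<le>3. monom (b i) i) = cubic (u b)" for b
    by (simp add: u_def cubic_def numeral_2_eq_2 numeral_3_eq_3 atMost_Suc monom_Suc monom_0)
  have F: "F0 = cubic (u a)" "F2 = cubic (u c)"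
    using assms(5,6) cubic by simp_all
  have "(vector [F0, 0, F2, 0] :: complex poly ^ 4) = cubics (vector [u a, 0, u c, 0])"
    by (simp add: F vec_eq_iff forall_4)
  then have "collapse_point 3 f \<longleftrightarrow> omega (u a) (u c) = 0"
    using in_closure_imp_omega_0[of "u a" "u c"] omega_0_imp_in_closure[of "u a" "u c"] assms(1,3,4)
    by (auto simp: collapse_point_def assms(2) CP1_in_CP3_rat_map simp flip: F)
  moreover have "omega (u a) (u c) = 3 * h 0 3 - h 1 2"
    "omega (u a) (u c) = 3 * a 0 * c 3 - a 1 * c 2 + a 2 * c 1 - 3 * a 3 * c 0"
    by (simp_all add: omega_def u_def assms(7) algebra_simps)
  ultimately show ?thesis by simp
qed
end
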